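(* Let $(W,S)$ be the finite Coxeter system of type $E_6$, that is, $S=\{s_1,s_2,s_3,s_4,s_5,s_6\}$ and $W$ is the group generated by $S$ subject to the relations $(s_is_j)^{m_{ij}}=1$, where $m_{ii}=1$, $m_{ij}=m_{ji}$, $m_{13}=m_{34}=m_{24}=m_{45}=m_{56}=3$, and all other $m_{ij}$ with $i\neq j$ equal $2$. Let $W(E_6)$ denote the set $W$ partially ordered by the right weak order $\leq_R$. Then the order dimension of this finite poset satisfies $\dim W(E_6)\geq 7$.
   Context: For a finite Coxeter system $(W,S)$, let $\ell$ denote Coxeter length with respect to $S$. The right weak order on $W$ is defined by $u\leq_R v$ if $v=uq$ for some $q\in W$ with $\ell(v)=\ell(u)+\ell(q)$. Equivalently, $u\leq_R v$ if and only if $\operatorname{Inv}(u)\subseteq\operatorname{Inv}(v)$, where $\operatorname{Inv}(w)=\{\alpha\in\Phi^+ : w^{-1}(\alpha)\in-\Phi^+\}$ and $\Phi^+$ is the set of positive roots of the associated root system. This poset is identified with the poset of regions of the Coxeter (reflection) arrangement of $W$ based at the fundamental region. A realizer of a finite poset $P$ is a collection of linear extensions of $P$ whose intersection (as relations) is the order of $P$. The order dimension $\dim P$ is the minimum size of a realizer of $P$; equivalently, it is the least $d$ such that $P$ admits an order embedding into $\mathbb{R}^d$ with the coordinatewise order. *)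

theory Defs
  imports "HOL-Algebra.Group" "HOL-Library.Extended_Nat"
begin

text \<open>The letter \<open>(a, True)\<close> stands for the generator \<open>a\<close>, the letter \<open>(a, False)\<close> for its inverse.\<close>

type_synonym 'a word = "('a \<times> bool) list"

abbreviation words :: "'a set \<Rightarrow> 'a word set" where
  "words S \<equiv> lists (S \<times> UNIV)"

inductive_set pres_rel :: "'a set \<Rightarrow> 'a word set \<Rightarrow> ('a word \<times> 'a word) set"
  for S :: "'a set" and R :: "'a word set" where
  refl: "w \<in> words S \<Longrightarrow> (w, w) \<in> pres_rel S R"
| sym: "(v, w) \<in> pres_rel S R \<Longrightarrow> (w, v) \<in> pres_rel S R"
| trans: "(u, v) \<in> pres_rel S R \<Longrightarrow> (v, w) \<in> pres_rel S R \<Longrightarrow> (u, w) \<in> pres_rel S R"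
| cancel: "u \<in> words S \<Longrightarrow> v \<in> words S \<Longrightarrow> a \<in> S \<Longrightarrow>
    (u @ [(a, e), (a, \<not> e)] @ v, u @ v) \<in> pres_rel S R"
| relator: "u \<in> words S \<Longrightarrow> v \<in> words S \<Longrightarrow> r \<in> R \<Longrightarrow> r \<in> words S \<Longrightarrow>
    (u @ r @ v, u @ v) \<in> pres_rel S R"

definition word_class :: "'a set \<Rightarrow> 'a word set \<Rightarrow> 'a word \<Rightarrow> 'a word set" where
  "word_class S R w = pres_rel S R `` {w}"

definition presented_group :: "'a set \<Rightarrow> 'a word set \<Rightarrow> 'a word set monoid" where
  "presented_group S R =
    \<lparr>carrier = words S // pres_rel S R,
     mult = (\<lambda>A B. pres_rel S R `` {x @ y | x y. x \<in> A \<and> y \<in> B}),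
     one = word_class S R []\<rparr>"

lemma pres_rel_words:
  "(v, w) \<in> pres_rel S R \<Longrightarrow> v \<in> words S \<and> w \<in> words S"
  by (induction rule: pres_rel.induct) simp_all

lemma equiv_pres_rel: "equiv (words S) (pres_rel S R)"
proof (rule equivI)
  show "pres_rel S R \<subseteq> words S \<times> words S"
    using pres_rel_words by fast
  show "refl_on (words S) (pres_rel S R)"
    by (rule refl_onI) (rule pres_rel.refl)
  show "sym (pres_rel S R)"
    by (rule symI) (rule pres_rel.sym)
  show "trans (pres_rel S R)"
    by (rule transI) (rule pres_rel.trans)
qed

lemma pres_rel_context:
  assumes "(v, w) \<in> pres_rel S R" "x \<in> words S" "y \<in> words S"
  shows "(x @ v @ y, x @ w @ y) \<in> pres_rel S R"
  using assms
proof (induction rule: pres_rel.induct)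
  case (refl w)
  then show ?case by (simp add: pres_rel.refl)
next
  case (sym v w)
  then show ?case by (simp add: pres_rel.sym)
next
  case (trans u v w)
  show ?case
    by (rule pres_rel.trans[OF trans.IH(1)[OF trans.prems] trans.IH(2)[OF trans.prems]])
next
  case (cancel u v a e)
  then show ?case using pres_rel.cancel[of "x @ u" S "v @ y" a e R] by auto
next
  case (relator u v r)
  then show ?case using pres_rel.relator[of "x @ u" S "v @ y" r R] by auto
qed

lemma pres_rel_append:
  assumes "(u, u') \<in> pres_rel S R" "(v, v') \<in> pres_rel S R"
  shows "(u @ v, u' @ v') \<in> pres_rel S R"
proof -
  have "(u @ v, u' @ v) \<in> pres_rel S R"
    using pres_rel_context[OF assms(1), of "[]" v] pres_rel_words[OF assms(2)] by simp
  moreover have "(u' @ v, u' @ v') \<in> pres_rel S R"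
    using pres_rel_context[OF assms(2), of u' "[]"] pres_rel_words[OF assms(1)] by simp
  ultimately show ?thesis by (rule pres_rel.trans)
qed

lemma word_class_eq_iff:
  assumes "v \<in> words S" "w \<in> words S"
  shows "word_class S R v = word_class S R w \<longleftrightarrow> (v, w) \<in> pres_rel S R"
  unfolding word_class_def using eq_equiv_class_iff[OF equiv_pres_rel assms] .

lemma carrier_presented_group:
  "carrier (presented_group S R) = word_class S R ` words S"
  by (auto simp: presented_group_def word_class_def quotient_def)

lemma one_presented_group: "\<one>\<^bsub>presented_group S R\<^esub> = word_class S R []"
  by (simp add: presented_group_def)

lemma mult_presented_group:
  assumes "v \<in> words S" "w \<in> words S"
  shows "word_class S R v \<otimes>\<^bsub>presented_group S R\<^esub> word_class S R w = word_class S R (v @ w)"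
proof -
  let ?C = "{x @ y | x y. x \<in> word_class S R v \<and> y \<in> word_class S R w}"
  have vw: "(v, v) \<in> pres_rel S R" "(w, w) \<in> pres_rel S R"
    using assms by (simp_all add: pres_rel.refl)
  have "pres_rel S R `` ?C = word_class S R (v @ w)"
  proof (rule equalityI)
    show "pres_rel S R `` ?C \<subseteq> word_class S R (v @ w)"
    proof
      fix z assume "z \<in> pres_rel S R `` ?C"
      then obtain x y where "(v, x) \<in> pres_rel S R" "(w, y) \<in> pres_rel S R" "(x @ y, z) \<in> pres_rel S R"
        unfolding word_class_def by blast
      then have "(v @ w, z) \<in> pres_rel S R"
        using pres_rel.trans[OF pres_rel_append] by metis
      then show "z \<in> word_class S R (v @ w)" by (simp add: word_class_def)
    qed
    have "v @ w \<in> ?C" using vw unfolding word_class_def by blast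
    then show "word_class S R (v @ w) \<subseteq> pres_rel S R `` ?C"
      unfolding word_class_def by blast
  qed
  then show ?thesis
    by (simp add: presented_group_def)
qed

definition inverse_word :: "'a word \<Rightarrow> 'a word" where
  "inverse_word w = rev (map (\<lambda>(a, e). (a, \<not> e)) w)"

lemma inverse_word_words: "w \<in> words S \<Longrightarrow> inverse_word w \<in> words S"
  by (induction w) (auto simp: inverse_word_def)

lemma inverse_word_cancel:
  "w \<in> words S \<Longrightarrow> (inverse_word w @ w, []) \<in> pres_rel S R"
proof (induction w)
  case Nil
  then show ?case by (simp add: inverse_word_def pres_rel.refl)
next
  case (Cons l w)
  obtain a e where l: "l = (a, e)" by (cases l)
  with Cons.prems have a: "a \<in> S" and w: "w \<in> words S" by auto
  have "inverse_word (l # w) @ l # w = inverse_word w @ [(a, \<not> e), (a, \<not> \<not> e)] @ w"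
    by (simp add: inverse_word_def l)
  then show ?case
    using pres_rel.cancel[OF inverse_word_words[OF w] w a, of "\<not> e" R] Cons.IH[OF w]
    by (metis pres_rel.trans)
qed

lemma group_presented_group: "group (presented_group S R)" (is "group ?G")
proof (rule groupI)
  fix x assume "x \<in> carrier ?G"
  then obtain w where w: "w \<in> words S" and x: "x = word_class S R w"
    unfolding carrier_presented_group by blast
  note iw = inverse_word_words[OF w]
  have "word_class S R (inverse_word w) \<otimes>\<^bsub>?G\<^esub> x = word_class S R (inverse_word w @ w)"
    unfolding x by (rule mult_presented_group[OF iw w])
  also have "\<dots> = \<one>\<^bsub>?G\<^esub>"
    using word_class_eq_iff[of "inverse_word w @ w" S "[]" R] iw w inverse_word_cancel[OF w, of R]
    by (simp add: one_presented_group)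
  finally show "\<exists>y\<in>carrier ?G. y \<otimes>\<^bsub>?G\<^esub> x = \<one>\<^bsub>?G\<^esub>"
    using iw unfolding carrier_presented_group by blast
next
  fix x y assume "x \<in> carrier ?G" "y \<in> carrier ?G"
  then obtain v w where vw: "v \<in> words S" "w \<in> words S"
    and xy: "x = word_class S R v" "y = word_class S R w"
    unfolding carrier_presented_group by blast
  have "v @ w \<in> words S" using vw by simp
  then show "x \<otimes>\<^bsub>?G\<^esub> y \<in> carrier ?G"
    unfolding xy mult_presented_group[OF vw] carrier_presented_group by (rule imageI)
next
  show "\<one>\<^bsub>?G\<^esub> \<in> carrier ?G"
    unfolding carrier_presented_group one_presented_group by (rule imageI) simp
next
  fix x y z assume "x \<in> carrier ?G" "y \<in> carrier ?G" "z \<in> carrier ?G"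
  then obtain u v w where uvw: "u \<in> words S" "v \<in> words S" "w \<in> words S"
    and xyz: "x = word_class S R u" "y = word_class S R v" "z = word_class S R w"
    unfolding carrier_presented_group by blast
  have app: "u @ v \<in> words S" "v @ w \<in> words S" using uvw by simp_all
  show "x \<otimes>\<^bsub>?G\<^esub> y \<otimes>\<^bsub>?G\<^esub> z = x \<otimes>\<^bsub>?G\<^esub> (y \<otimes>\<^bsub>?G\<^esub> z)"
    unfolding xyz mult_presented_group[OF uvw(1,2)] mult_presented_group[OF uvw(2,3)]
      mult_presented_group[OF app(1) uvw(3)] mult_presented_group[OF uvw(1) app(2)] by simp
next
  fix x assume "x \<in> carrier ?G"
  then obtain w where w: "w \<in> words S" and x: "x = word_class S R w"
    unfolding carrier_presented_group by blast
  show "\<one>\<^bsub>?G\<^esub> \<otimes>\<^bsub>?G\<^esub> x = x"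
    unfolding x one_presented_group using mult_presented_group[of "[]" S w R] w by simp
qed

text \<open>With the convention \<open>m i j = 0\<close> for \<open>m\<^sub>i\<^sub>j = \<infinity>\<close>, the relator is the empty word, i.e. no relation
  is imposed.\<close>

definition coxeter_relators :: "'i set \<Rightarrow> ('i \<Rightarrow> 'i \<Rightarrow> nat) \<Rightarrow> 'i word set" where
  "coxeter_relators I m =
    {concat (replicate (m i j) [(i, True), (j, True)]) | i j. i \<in> I \<and> j \<in> I}"

definition coxeter_group :: "'i set \<Rightarrow> ('i \<Rightarrow> 'i \<Rightarrow> nat) \<Rightarrow> 'i word set monoid" where
  "coxeter_group I m = presented_group I (coxeter_relators I m)"

definition coxeter_generators :: "'i set \<Rightarrow> ('i \<Rightarrow> 'i \<Rightarrow> nat) \<Rightarrow> 'i word set set" where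
  "coxeter_generators I m = (\<lambda>i. word_class I (coxeter_relators I m) [(i, True)]) ` I"

text \<open>Only products of elements of \<open>S\<close>, not of their inverses, are considered. This is the usual
  Coxeter length, since the Coxeter generators are involutions.\<close>

definition word_length :: "('g, 'b) monoid_scheme \<Rightarrow> 'g set \<Rightarrow> 'g \<Rightarrow> nat" where
  "word_length G S w =
    (LEAST n. \<exists>ss. length ss = n \<and> set ss \<subseteq> S \<and> foldr (\<otimes>\<^bsub>G\<^esub>) ss \<one>\<^bsub>G\<^esub> = w)"

definition right_weak_order :: "('g, 'b) monoid_scheme \<Rightarrow> 'g set \<Rightarrow> 'g rel" where
  "right_weak_order G S =
    {(u, v). u \<in> carrier G \<and> v \<in> carrier G \<and>
      (\<exists>q\<in>carrier G. v = u \<otimes>\<^bsub>G\<^esub> q \<and>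
        word_length G S v = word_length G S u + word_length G S q)}"

definition e6_matrix :: "nat \<Rightarrow> nat \<Rightarrow> nat" where
  "e6_matrix i j =
    (if i = j then 1
     else if {i, j} \<in> {{1, 3}, {3, 4}, {2, 4}, {4, 5}, {5, 6}} then 3
     else 2)"

definition linear_extension :: "'a set \<Rightarrow> 'a rel \<Rightarrow> 'a rel \<Rightarrow> bool" where
  "linear_extension A r L \<longleftrightarrow> linear_order_on A L \<and> r \<subseteq> L"

text \<open>The intersection is taken inside \<open>A \<times> A\<close>, so that the empty collection realizes a one-element
  poset, in accordance with that poset embedding into the zero-dimensional space.\<close>

definition realizer :: "'a set \<Rightarrow> 'a rel \<Rightarrow> 'a rel set \<Rightarrow> bool" where
  "realizer A r \<R> \<longleftrightarrow> (\<forall>L\<in>\<R>. linear_extension A r L) \<and> A \<times> A \<inter> \<Inter>\<R> = r"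

text \<open>The infimum in \<^typ>\<open>enat\<close> is attained whenever there is a finite realizer, in particular for
  every finite poset; it is \<open>\<infinity>\<close> if there is none.\<close>

definition order_dimension :: "'a set \<Rightarrow> 'a rel \<Rightarrow> enat" where
  "order_dimension A r = (INF \<R>\<in>{\<R>. finite \<R> \<and> realizer A r \<R>}. enat (card \<R>))"

end

theory Submission
  imports Defs
begin

text \<open>
  If \<open>a\<^sub>x \<le> b\<^sub>y\<close> and \<open>a\<^sub>y \<le> b\<^sub>x\<close>, then no linear extension reverses both of the pairs
  \<open>(a\<^sub>x, b\<^sub>x)\<close> and \<open>(a\<^sub>y, b\<^sub>y)\<close>. Hence a realizer properly colours the conflict graph of any set of
  pairs with \<open>a\<^sub>x \<not>\<le> b\<^sub>x\<close>. In the weak order of type \<open>E\<^sub>6\<close>, fifteen critical pairs suffice: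
  the six simple reflections give a 6-clique, and relative to six colours indexed by that clique each
  of the nine remaining pairs has only two admissible colours. The nine pairs form two 5-cycles with
  a common vertex; either colour of that vertex makes one of the cycles impossible to colour.

  The comparisons reduce to Coxeter lengths of explicit words. Let \<open>c\<^sub>w(s)\<close> be the height of the root
  \<open>w \<alpha>\<^sub>s\<close>. Then \<open>\<ell>(w s) > \<ell>(w)\<close> iff \<open>c\<^sub>w(s) > 0\<close>, and passing from \<open>w\<close> to \<open>w t\<close> changes \<open>c\<^sub>w\<close> by a
  move of Mozes's numbers game, so lengths can be computed letter by letter.
\<close>

section \<open>Order dimension and colourings of conflict graphs\<close>

lemma order_dimension_ge:
  fixes a b :: "'v \<Rightarrow> 'a" and d :: nat
  assumes vert: "\<And>x. x \<in> V \<Longrightarrow> a x \<in> A \<and> b x \<in> A \<and> (a x, b x) \<notin> r"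
    and edge: "\<And>x y. (x, y) \<in> E \<Longrightarrow> x \<in> V \<and> y \<in> V \<and> (a x, b y) \<in> r \<and> (a y, b x) \<in> r"
    and col: "\<And>(f :: 'v \<Rightarrow> 'a rel) C. \<lbrakk>finite C; f ` V \<subseteq> C; \<And>x y. (x, y) \<in> E \<Longrightarrow> f x \<noteq> f y\<rbrakk> \<Longrightarrow> d \<le> card C"
  shows "enat d \<le> order_dimension A r"
  unfolding order_dimension_def
proof (rule INF_greatest)
  fix \<R> :: "'a rel set"
  assume "\<R> \<in> {\<R>. finite \<R> \<and> realizer A r \<R>}"
  then have fin: "finite \<R>" and lin: "\<And>L. L \<in> \<R> \<Longrightarrow> linear_order_on A L \<and> r \<subseteq> L"
    and int: "A \<times> A \<inter> \<Inter>\<R> = r"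
    by (auto simp: realizer_def linear_extension_def)
  \<comment> \<open>A pair from \<open>A\<close> outside \<open>r\<close> is missing from some
    member of the realizer; choosing such a member gives the colour \<open>f x\<close>.\<close>
  have "\<exists>L\<in>\<R>. (a x, b x) \<notin> L" if "x \<in> V" for x
    using vert[OF that] int by blast
  then obtain f where f: "\<And>x. x \<in> V \<Longrightarrow> f x \<in> \<R> \<and> (a x, b x) \<notin> f x" by metis
  have "f x \<noteq> f y" if xy: "(x, y) \<in> E" for x y
  proof
    assume eq: "f x = f y"
    have V: "x \<in> V" "y \<in> V" using edge[OF xy] by auto
    let ?L = "f x"
    have lo: "linear_order_on A ?L" and sub: "r \<subseteq> ?L" using lin f[OF V(1)] by auto
    have tot: "(u, v) \<in> ?L \<or> (v, u) \<in> ?L" if "u \<in> A" "v \<in> A" for u v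
      using lo that unfolding linear_order_on_def partial_order_on_def preorder_on_def
      by (cases "u = v") (simp_all add: refl_on_def total_on_def)
    have tr: "trans ?L"
      using lo unfolding linear_order_on_def partial_order_on_def preorder_on_def by blast
    \<comment> \<open>Totality reverses the second pair, so \<open>a x\<close>, \<open>b y\<close>,
      \<open>a y\<close>, \<open>b x\<close> form a chain in the common extension.\<close>
    have "(b y, a y) \<in> ?L" using tot[of "a y" "b y"] vert[OF V(2)] f[OF V(2)] eq by auto
    moreover have "(a x, b y) \<in> ?L" "(a y, b x) \<in> ?L" using edge[OF xy] sub by auto
    ultimately have "(a x, b x) \<in> ?L" using transD[OF tr] by metis
    with f[OF V(1)] show False by simp
  qed
  moreover have "f ` V \<subseteq> \<R>" using f by auto
  ultimately have "d \<le> card \<R>" using col[OF fin] by metis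
  then show "enat d \<le> enat (card \<R>)" by simp
qed

section \<open>Words and length in simply laced Coxeter groups\<close>

lemma words_map_True: "map (\<lambda>i. (i, True)) xs \<in> words I \<longleftrightarrow> xs \<in> lists I"
  by (induction xs) auto

locale simply_laced =
  fixes I :: "'i set" and m :: "'i \<Rightarrow> 'i \<Rightarrow> nat"
  assumes m_diag: "i \<in> I \<Longrightarrow> m i i = 1"
    and m_sym: "m i j = m j i"
    and m_off: "i \<in> I \<Longrightarrow> j \<in> I \<Longrightarrow> i \<noteq> j \<Longrightarrow> m i j = 2 \<or> m i j = 3"
begin

abbreviation "R \<equiv> coxeter_relators I m"
abbreviation "W \<equiv> coxeter_group I m"
abbreviation "S \<equiv> coxeter_generators I m"

text \<open>Inverse letters can be left out because the length counts only products of the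
  generators themselves.\<close>

definition elt :: "'i list \<Rightarrow> 'i word set" where
  "elt xs = word_class I R (map (\<lambda>i. (i, True)) xs)"

definition len :: "'i list \<Rightarrow> nat" where
  "len xs = word_length W S (elt xs)"

lemma group_W: "group W"
  unfolding coxeter_group_def by (rule group_presented_group)

lemma elt_eq_iff:
  assumes "xs \<in> lists I" "ys \<in> lists I"
  shows "elt xs = elt ys \<longleftrightarrow> (map (\<lambda>i. (i, True)) xs, map (\<lambda>i. (i, True)) ys) \<in> pres_rel I R"
  unfolding elt_def using assms by (intro word_class_eq_iff) (simp_all only: words_map_True)

lemma elt_Nil: "elt [] = \<one>\<^bsub>W\<^esub>"
  by (simp add: elt_def coxeter_group_def one_presented_group)

lemma elt_append:
  assumes "xs \<in> lists I" "ys \<in> lists I"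
  shows "elt (xs @ ys) = elt xs \<otimes>\<^bsub>W\<^esub> elt ys"
  unfolding elt_def coxeter_group_def using assms
  by (subst mult_presented_group) (simp_all only: words_map_True map_append)

lemma elt_carrier: "xs \<in> lists I \<Longrightarrow> elt xs \<in> carrier W"
  unfolding elt_def coxeter_group_def carrier_presented_group by (simp only: words_map_True imageI)

lemma elt_relator:
  assumes "xs \<in> lists I" "ys \<in> lists I" "i \<in> I" "j \<in> I"
  shows "elt (xs @ concat (replicate (m i j) [i, j]) @ ys) = elt (xs @ ys)"
proof -
  let ?p = "map (\<lambda>i. (i, True))"
  have r: "?p (concat (replicate n [i, j])) = concat (replicate n [(i, True), (j, True)])" for n
    by (induction n) auto
  have l: "concat (replicate n [i, j]) \<in> lists I" for n
    using assms(3,4) by (induction n) auto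
  have "?p (concat (replicate (m i j) [i, j])) \<in> R"
    unfolding r coxeter_relators_def using assms(3,4) by blast
  then have "(?p xs @ ?p (concat (replicate (m i j) [i, j])) @ ?p ys, ?p xs @ ?p ys) \<in> pres_rel I R"
    using assms l by (intro pres_rel.relator) (simp_all only: words_map_True)
  then show ?thesis
    using assms l by (subst elt_eq_iff) (simp_all only: map_append append_in_lists_conv)
qed

lemma elt_cancel:
  assumes "xs \<in> lists I" "ys \<in> lists I" "i \<in> I"
  shows "elt (xs @ i # i # ys) = elt (xs @ ys)"
  using elt_relator[OF assms(1,2,3,3)] m_diag[OF assms(3)] by simp

text \<open>Insert the relator before the right-hand word and cancel doubled letters;
  \<open>elt_braid\<close> works alike.\<close>

lemma elt_comm:
  assumes "xs \<in> lists I" "i \<in> I" "j \<in> I" "m i j = 2"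
  shows "elt (xs @ [i, j]) = elt (xs @ [j, i])"
proof -
  have "elt (xs @ [j, i]) = elt (xs @ [i, j, i, j, j, i])"
    using elt_relator[of xs "[j, i]" i j] assms by (simp add: numeral_2_eq_2)
  also have "\<dots> = elt (xs @ [i, j, i, i])"
    using elt_cancel[of "xs @ [i, j, i]" "[i]" j] assms by simp
  also have "\<dots> = elt (xs @ [i, j])"
    using elt_cancel[of "xs @ [i, j]" "[]" i] assms by simp
  finally show ?thesis ..
qed

lemma elt_braid:
  assumes "xs \<in> lists I" "i \<in> I" "j \<in> I" "m i j = 3"
  shows "elt (xs @ [i, j, i]) = elt (xs @ [j, i, j])"
proof -
  have "elt (xs @ [j, i, j]) = elt (xs @ [i, j, i, j, i, j, j, i, j])"
    using elt_relator[of xs "[j, i, j]" i j] assms by (simp add: numeral_3_eq_3)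
  also have "\<dots> = elt (xs @ [i, j, i, j, i, i, j])"
    using elt_cancel[of "xs @ [i, j, i, j, i]" "[i, j]" j] assms by simp
  also have "\<dots> = elt (xs @ [i, j, i, j, j])"
    using elt_cancel[of "xs @ [i, j, i, j]" "[j]" i] assms by simp
  also have "\<dots> = elt (xs @ [i, j, i])"
    using elt_cancel[of "xs @ [i, j, i]" "[]" j] assms by simp
  finally show ?thesis ..
qed

lemma elt_snoc_cong:
  assumes "elt xs = elt ys" "xs \<in> lists I" "ys \<in> lists I" "i \<in> I"
  shows "elt (xs @ [i]) = elt (ys @ [i])"
  using assms by (simp add: elt_append)

lemma elt_rev_left:
  assumes "xs \<in> lists I" "ys \<in> lists I"
  shows "elt (rev xs @ xs @ ys) = elt ys"
  using assms
proof (induction xs)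
  case (Cons x xs)
  moreover from Cons have "rev xs \<in> lists I" by auto
  ultimately show ?case using elt_cancel[of "rev xs" "xs @ ys" x] by simp
qed simp

text \<open>Moves the length from lists of group elements to index words, on which all later
  arguments operate.\<close>

lemma len_altdef: "len xs = (LEAST n. \<exists>ys. length ys = n \<and> ys \<in> lists I \<and> elt ys = elt xs)"
proof -
  have fold: "foldr (\<otimes>\<^bsub>W\<^esub>) (map (\<lambda>i. elt [i]) ys) \<one>\<^bsub>W\<^esub> = elt ys" if "ys \<in> lists I" for ys
    using that
  proof (induction ys)
    case (Cons i ys)
    then show ?case using elt_append[of "[i]" ys] by simp
  qed (simp add: elt_Nil)
  have S: "S = (\<lambda>i. elt [i]) ` I"
    by (simp add: coxeter_generators_def elt_def)
  have "(\<exists>ss. length ss = n \<and> set ss \<subseteq> S \<and> foldr (\<otimes>\<^bsub>W\<^esub>) ss \<one>\<^bsub>W\<^esub> = w) \<longleftrightarrow>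
    (\<exists>ys. length ys = n \<and> ys \<in> lists I \<and> elt ys = w)" (is "?l \<longleftrightarrow> ?r") for n w
  proof
    assume ?l
    then obtain ss where ss: "length ss = n" "ss \<in> lists ((\<lambda>i. elt [i]) ` I)"
      "foldr (\<otimes>\<^bsub>W\<^esub>) ss \<one>\<^bsub>W\<^esub> = w"
      unfolding S by auto
    then obtain ys where "ys \<in> lists I" "ss = map (\<lambda>i. elt [i]) ys"
      unfolding lists_image by blast
    with ss fold show ?r by auto
  next
    assume ?r
    then obtain ys where ys: "length ys = n" "ys \<in> lists I" "elt ys = w" by blast
    with fold show ?l by (intro exI[of _ "map (\<lambda>i. elt [i]) ys"]) (auto simp: S)
  qed
  then show ?thesis unfolding len_def word_length_def by simp
qed

lemma len_cong: "elt xs = elt ys \<Longrightarrow> len xs = len ys"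
  by (simp add: len_def)

lemma len_le_length: "xs \<in> lists I \<Longrightarrow> len xs \<le> length xs"
  unfolding len_altdef by (rule Least_le) blast

lemma reduced_word:
  assumes "xs \<in> lists I"
  obtains ys where "ys \<in> lists I" "elt ys = elt xs" "length ys = len xs"
proof -
  have "\<exists>ys. length ys = len xs \<and> ys \<in> lists I \<and> elt ys = elt xs"
    unfolding len_altdef by (rule LeastI) (use assms in blast)
  then show ?thesis using that by blast
qed

text \<open>Every relator has even length. This sign character later rules out that appending a
  letter preserves the length.\<close>

lemma pres_rel_parity: "(v, w) \<in> pres_rel I R \<Longrightarrow> even (length v) = even (length w)"
proof (induction rule: pres_rel.induct)
  case (relator u v r)
  have "even (length (concat (replicate n [x, y])))" for n and x y :: "'i \<times> bool"
    by (induction n) auto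
  moreover obtain n x y where "r = concat (replicate n [x, y])"
    using relator.hyps(3) unfolding coxeter_relators_def by blast
  ultimately show ?case by simp
qed simp_all

lemma len_parity:
  assumes "xs \<in> lists I"
  shows "even (len xs) = even (length xs)"
proof -
  obtain ys where ys: "ys \<in> lists I" "elt ys = elt xs" "length ys = len xs"
    using reduced_word[OF assms] .
  have "even (length ys) = even (length xs)"
    using pres_rel_parity[OF elt_eq_iff[OF ys(1) assms, THEN iffD1, OF ys(2)]] by (simp only: length_map)
  then show ?thesis unfolding ys(3) .
qed

lemma len_snoc_le:
  assumes "xs \<in> lists I" "i \<in> I"
  shows "len (xs @ [i]) \<le> len xs + 1"
proof -
  obtain ys where ys: "ys \<in> lists I" "elt ys = elt xs" "length ys = len xs"
    using reduced_word[OF assms(1)] .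
  have "len (xs @ [i]) = len (ys @ [i])"
    by (rule len_cong[OF elt_snoc_cong[OF ys(2,1) assms, symmetric]])
  also have "\<dots> \<le> len xs + 1" using len_le_length[of "ys @ [i]"] ys assms by simp
  finally show ?thesis .
qed

lemma len_snoc_snoc:
  assumes "xs \<in> lists I" "i \<in> I"
  shows "len (xs @ [i, i]) = len xs"
  using elt_cancel[of xs "[]" i] assms by (intro len_cong) simp

lemma len_snoc_cases:
  assumes "xs \<in> lists I" "i \<in> I"
  shows "len (xs @ [i]) = len xs + 1 \<or> len (xs @ [i]) + 1 = len xs"
proof -
  have "len xs \<le> len (xs @ [i]) + 1"
    using len_snoc_le[of "xs @ [i]" i] len_snoc_snoc[OF assms] assms by simp
  moreover have "len (xs @ [i]) \<noteq> len xs"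
    using len_parity[of xs] len_parity[of "xs @ [i]"] assms by auto
  ultimately show ?thesis using len_snoc_le[OF assms] by linarith
qed

section \<open>The numbers game and its relation to length\<close>

text \<open>The vector \<open>c\<close> lists the heights of the roots \<open>w \<alpha>\<^sub>j\<close>, and \<open>fire i c\<close> those of the roots \<open>w s\<^sub>i \<alpha>\<^sub>j\<close>.
  The identity element corresponds to the constant vector 1.\<close>

definition fire :: "'i \<Rightarrow> ('i \<Rightarrow> int) \<Rightarrow> 'i \<Rightarrow> int" where
  "fire i c = (\<lambda>j. if j = i then - c i else if m j i = 3 then c j + c i else c j)"

definition game :: "'i list \<Rightarrow> ('i \<Rightarrow> int) \<Rightarrow> 'i \<Rightarrow> int" where
  "game xs c = fold fire xs c"

lemma fire_same: "fire i c i = - c i"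
  and fire_adjacent: "j \<noteq> i \<Longrightarrow> m j i = 3 \<Longrightarrow> fire i c j = c j + c i"
  and fire_other: "j \<noteq> i \<Longrightarrow> m j i \<noteq> 3 \<Longrightarrow> fire i c j = c j"
  by (simp_all add: fire_def)

lemma fire_fire: "fire i (fire i c) = c"
  by (rule ext) (simp add: fire_def)

lemma fire_comm:
  assumes "m i j = 2" "i \<noteq> j"
  shows "fire i (fire j c) = fire j (fire i c)"
proof
  have ji: "m j i = 2" using assms(1) m_sym by metis
  fix k
  consider "k = i" | "k = j" | "k \<noteq> i" "k \<noteq> j" "m k i = 3" "m k j = 3"
    | "k \<noteq> i" "k \<noteq> j" "m k i = 3" "m k j \<noteq> 3" | "k \<noteq> i" "k \<noteq> j" "m k i \<noteq> 3" "m k j = 3"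
    | "k \<noteq> i" "k \<noteq> j" "m k i \<noteq> 3" "m k j \<noteq> 3"
    by blast
  then show "fire i (fire j c) k = fire j (fire i c) k"
    using assms ji by cases (simp_all add: fire_same fire_adjacent fire_other)
qed

lemma fire_braid:
  assumes "m i j = 3" "i \<noteq> j"
  shows "fire i (fire j (fire i c)) = fire j (fire i (fire j c))"
proof
  have ji: "m j i = 3" using assms(1) m_sym by metis
  fix k
  consider "k = i" | "k = j" | "k \<noteq> i" "k \<noteq> j" "m k i = 3" "m k j = 3"
    | "k \<noteq> i" "k \<noteq> j" "m k i = 3" "m k j \<noteq> 3" | "k \<noteq> i" "k \<noteq> j" "m k i \<noteq> 3" "m k j = 3"
    | "k \<noteq> i" "k \<noteq> j" "m k i \<noteq> 3" "m k j \<noteq> 3"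
    by blast
  then show "fire i (fire j (fire i c)) k = fire j (fire i (fire j c)) k"
    using assms ji by cases (simp_all add: fire_same fire_adjacent fire_other)
qed

text \<open>Involutivity with the commutation or braid relation of firings gives each case; hence
  the game is well defined on group elements.\<close>

lemma fire_relator:
  assumes "i \<in> I" "j \<in> I"
  shows "fold fire (concat (replicate (m i j) [i, j])) c = c"
proof (cases "i = j")
  case True
  then show ?thesis using assms by (simp add: m_diag fire_fire)
next
  case False
  then consider "m i j = 2" | "m i j = 3" using m_off assms by blast
  then show ?thesis
  proof cases
    case 1
    then show ?thesis using fire_comm[OF 1 False] by (simp add: numeral_2_eq_2 fire_fire)
  next
    case 2
    have "fold fire (concat (replicate 3 [i, j])) c = fire j (fire i (fire j (fire i (fire j (fire i c)))))"
      by (simp add: numeral_3_eq_3)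
    also have "\<dots> = c" unfolding fire_braid[OF 2 False] by (simp only: fire_fire)
    finally show ?thesis using 2 by simp
  qed
qed

text \<open>Firing is an involution, so a letter and its inverse act alike and
  \<open>map fst\<close> may forget the flag.\<close>

lemma pres_rel_fire: "(v, w) \<in> pres_rel I R \<Longrightarrow> fold fire (map fst v) c = fold fire (map fst w) c"
proof (induction arbitrary: c rule: pres_rel.induct)
  case (relator u v r)
  from relator.hyps obtain i j where ij: "i \<in> I" "j \<in> I"
    and r: "r = concat (replicate (m i j) [(i, True), (j, True)])"
    by (auto simp: coxeter_relators_def)
  have "map fst r = concat (replicate (m i j) [i, j])"
    unfolding r by (simp add: map_concat)
  then show ?case using fire_relator[OF ij] by simp
qed (simp_all add: fire_fire)

lemma game_cong:
  assumes "elt xs = elt ys" "xs \<in> lists I" "ys \<in> lists I"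
  shows "game xs c = game ys c"
  using pres_rel_fire[of "map (\<lambda>i. (i, True)) xs" "map (\<lambda>i. (i, True)) ys"] assms
  by (simp add: game_def elt_eq_iff o_def)

lemma game_snoc: "game (xs @ [i]) c = fire i (game xs c)"
  by (simp add: game_def)

text \<open>The roots themselves are not needed: writing \<open>w = v t\<close> with \<open>\<ell>(v) < \<ell>(w)\<close>, either
  \<open>c\<^sub>w(s) \<in> {c\<^sub>v(s), c\<^sub>v(s) + c\<^sub>v(t)}\<close> with positive summands, or \<open>w = u s t\<close> and \<open>c\<^sub>w(s) = c\<^sub>u(t)\<close>.\<close>

lemma game_pos:
  assumes "xs \<in> lists I" "s \<in> I" "len (xs @ [s]) > len xs"
  shows "game xs (\<lambda>_. 1) s > 0"
  using assms
proof (induction "len xs" arbitrary: xs s rule: less_induct)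
  case less
  let ?c = "\<lambda>xs. game xs (\<lambda>_. 1)"
  note I = less.prems(1,2) and up = less.prems(3)
  obtain ws where ws: "ws \<in> lists I" "elt ws = elt xs" "length ws = len xs"
    using reduced_word[OF I(1)] .
  show ?case
  proof (cases ws rule: rev_cases)
    case Nil
    then show ?thesis using game_cong[OF ws(2,1) I(1)] by (auto simp: game_def dest: fun_cong)
  next
    case (snoc vs t)
    then have vt: "vs \<in> lists I" "t \<in> I" using ws(1) by auto
    have gx: "?c xs = fire t (?c vs)"
      using game_cong[OF ws(2,1) I(1)] snoc by (simp add: game_snoc)
    have lv: "len vs + 1 = len xs"
      using len_le_length[OF vt(1)] len_snoc_le[OF vt] ws(2,3) snoc len_cong[OF ws(2)] by simp
    have vt_up: "len (vs @ [t]) > len vs" using lv snoc len_cong[OF ws(2)] by simp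
    have ws_s: "len (ws @ [s]) = len xs + 1"
      using len_snoc_cases[OF I] up len_cong[OF elt_snoc_cong[OF ws(2,1) I]] by simp
    have st: "s \<noteq> t"
      using ws_s len_snoc_snoc[OF vt] lv unfolding snoc by auto
    have IHt: "?c vs t > 0" using less.hyps[OF _ vt vt_up] lv by simp
    show ?thesis
    proof (cases "len (vs @ [s]) > len vs")
      case True
      have "?c vs s > 0" using less.hyps[OF _ vt(1) I(2) True] lv by simp
      then show ?thesis using IHt st unfolding gx by (simp add: fire_def)
    next
      case False
      with len_snoc_cases[OF vt(1) I(2)] have vs_down: "len (vs @ [s]) + 1 = len vs" by auto
      let ?u = "vs @ [s]"
      have u: "?u \<in> lists I" using vt(1) I(2) by simp
      have us: "elt (?u @ [s]) = elt vs" using elt_cancel[of vs "[]" s] vt(1) I(2) by simp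
      have "m s t = 3"
      proof (rule ccontr)
        \<comment> \<open>If s and t commuted, w s = v s t = u t would have length at most l(u) + 1,
          yet l(w s) = l(u) + 3.\<close>
        assume "m s t \<noteq> 3"
        then have "m s t = 2" using m_off[OF I(2) vt(2)] st by blast
        have "elt (ws @ [s]) = elt (vs @ [t, s])" using snoc by simp
        also have "\<dots> = elt (?u @ [t])" using elt_comm[OF vt(1) I(2) vt(2) \<open>m s t = 2\<close>] by simp
        finally have "len (ws @ [s]) \<le> len ?u + 1" using len_snoc_le[OF u vt(2)] len_cong by metis
        then show False using ws_s vs_down lv by simp
      qed
      have "len (?u @ [t]) > len ?u"
      proof (rule ccontr)
        \<comment> \<open>Otherwise w s = u s t s = u t s t again has length at most l(u) +
          1.\<close>
        assume "\<not> len (?u @ [t]) > len ?u"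
        with len_snoc_cases[OF u vt(2)] have down: "len (?u @ [t]) + 1 = len ?u" by auto
        have "elt (ws @ [s]) = elt (vs @ [t, s])" using snoc by simp
        also have "\<dots> = elt ((?u @ [s]) @ [t, s])"
          using us vt(1) I(2) vt(2) u by (metis elt_append lists.Cons lists.Nil append_in_lists_conv)
        also have "\<dots> = elt (?u @ [s, t, s])" by simp
        also have "\<dots> = elt ((?u @ [t]) @ [s] @ [t])"
          using elt_braid[OF u I(2) vt(2) \<open>m s t = 3\<close>] by simp
        finally have "len (ws @ [s]) = len ((?u @ [t]) @ [s] @ [t])" by (rule len_cong)
        also have "\<dots> \<le> len (?u @ [t]) + 2"
          using len_snoc_le[of "?u @ [t]" s] len_snoc_le[of "?u @ [t] @ [s]" t] u vt(2) I(2) by simp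
        finally show False using ws_s down vs_down lv by simp
      qed
      then have pos: "?c ?u t > 0" using less.hyps[OF _ u vt(2)] vs_down lv by simp
      have "?c vs = fire s (?c ?u)"
        by (simp add: game_snoc fire_fire)
      moreover have "m t s = 3" using \<open>m s t = 3\<close> m_sym by metis
      \<comment> \<open>The sum of c_v(s) = -c_u(s) and c_v(t) = c_u(t) + c_u(s) is c_u(t).\<close>
      ultimately have "?c xs s = ?c ?u t"
        unfolding gx using st \<open>m s t = 3\<close> by (simp add: fire_def)
      with pos show ?thesis by simp
    qed
  qed
qed

text \<open>The converse of \<open>game_pos\<close> follows from it: if i shortens w, it lengthens w
  i, and firing i negates the entry at i.\<close>

lemma len_snoc:
  assumes "xs \<in> lists I" "i \<in> I"
  shows "int (len (xs @ [i])) = int (len xs) + (if game xs (\<lambda>_. 1) i > 0 then 1 else - 1)"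
proof (cases "len (xs @ [i]) > len xs")
  case True
  then show ?thesis using game_pos[OF assms] len_snoc_cases[OF assms] by auto
next
  case False
  then have down: "len (xs @ [i]) + 1 = len xs" using len_snoc_cases[OF assms] by auto
  have "game (xs @ [i]) (\<lambda>_. 1) i > 0"
    using game_pos[of "xs @ [i]" i] down len_snoc_snoc[OF assms] assms by simp
  then show ?thesis using down by (simp add: game_snoc fire_def)
qed

text \<open>Reading from the front allows evaluation by rewriting; \<open>score_snoc\<close>
  restores the view from the end that \<open>len_snoc\<close> needs.\<close>

primrec score :: "'i list \<Rightarrow> ('i \<Rightarrow> int) \<Rightarrow> int" where
  "score [] c = 0"
| "score (i # xs) c = (if c i > 0 then 1 else - 1) + score xs (fire i c)"

lemma score_snoc: "score (xs @ [i]) c = score xs c + (if game xs c i > 0 then 1 else - 1)"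
  by (induction xs arbitrary: c) (auto simp: game_def)

lemma len_eq_score: "xs \<in> lists I \<Longrightarrow> int (len xs) = score xs (\<lambda>_. 1)"
proof (induction xs rule: rev_induct)
  case Nil
  then show ?case using len_le_length[of "[]"] by simp
next
  case (snoc i xs)
  then show ?case by (simp add: len_snoc score_snoc)
qed

text \<open>By cancellation the only possible witness is the quotient of the two elements, and
  reversing a word of involutions inverts it.\<close>

lemma right_weak_order_iff:
  assumes "xs \<in> lists I" "ys \<in> lists I"
  shows "(elt xs, elt ys) \<in> right_weak_order W S \<longleftrightarrow>
    score ys (\<lambda>_. 1) = score xs (\<lambda>_. 1) + score (rev xs @ ys) (\<lambda>_. 1)"
proof -
  let ?q = "elt (rev xs @ ys)"
  have rx: "rev xs \<in> lists I" using assms(1) by auto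
  then have rxy: "rev xs @ ys \<in> lists I" using assms(2) by simp
  then have q: "?q \<in> carrier W" by (rule elt_carrier)
  have "elt xs \<otimes>\<^bsub>W\<^esub> ?q = elt (rev (rev xs) @ rev xs @ ys)"
    using elt_append[OF assms(1) rxy] by simp
  also have "\<dots> = elt ys" by (rule elt_rev_left[OF rx assms(2)])
  finally have prod: "elt xs \<otimes>\<^bsub>W\<^esub> ?q = elt ys" .
  have uniq: "p = ?q" if p: "p \<in> carrier W" and eq: "elt ys = elt xs \<otimes>\<^bsub>W\<^esub> p" for p
  proof -
    have "elt xs \<in> Units W" using elt_carrier[OF assms(1)] group.Units_eq[OF group_W] by blast
    then show ?thesis
      using monoid.Units_l_cancel[OF group.is_monoid[OF group_W] _ p q] HOL.trans[OF eq[symmetric] prod[symmetric]]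
      by blast
  qed
  have "(elt xs, elt ys) \<in> right_weak_order W S \<longleftrightarrow> len ys = len xs + len (rev xs @ ys)"
  proof
    assume "(elt xs, elt ys) \<in> right_weak_order W S"
    then obtain p where p: "p \<in> carrier W" "elt ys = elt xs \<otimes>\<^bsub>W\<^esub> p"
      and l: "len ys = len xs + word_length W S p"
      unfolding right_weak_order_def len_def mem_Collect_eq case_prod_conv by blast
    show "len ys = len xs + len (rev xs @ ys)"
      using l unfolding uniq[OF p] by (simp only: len_def)
  next
    assume l: "len ys = len xs + len (rev xs @ ys)"
    have "\<exists>q\<in>carrier W. elt ys = elt xs \<otimes>\<^bsub>W\<^esub> q \<and>
        word_length W S (elt ys) = word_length W S (elt xs) + word_length W S q"
      by (intro bexI[OF _ q] conjI prod[symmetric] l[unfolded len_def])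
    then show "(elt xs, elt ys) \<in> right_weak_order W S"
      unfolding right_weak_order_def mem_Collect_eq case_prod_conv
      by (intro conjI elt_carrier assms)
  qed
  also have "\<dots> \<longleftrightarrow> int (len ys) = int (len xs) + int (len (rev xs @ ys))" by linarith
  finally show ?thesis unfolding len_eq_score[OF assms(1)] len_eq_score[OF assms(2)] len_eq_score[OF rxy] .
qed

end

section \<open>Explicit comparisons in type E6\<close>

interpretation e6: simply_laced "{1..6}" e6_matrix
  by standard (auto simp: e6_matrix_def insert_commute)

text \<open>The base function 1 makes the constant start vector itself a state.\<close>

definition e6_state :: "int \<Rightarrow> int \<Rightarrow> int \<Rightarrow> int \<Rightarrow> int \<Rightarrow> int \<Rightarrow> nat \<Rightarrow> int" where
  "e6_state c1 c2 c3 c4 c5 c6 = (\<lambda>_. 1)(1 := c1, 2 := c2, 3 := c3, 4 := c4, 5 := c5, 6 := c6)"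

lemma e6_state_init: "(\<lambda>_. 1) = e6_state 1 1 1 1 1 1"
  by (auto simp: e6_state_def)

lemma e6_matrix_eq_3:
  "e6_matrix i j = 3 \<longleftrightarrow> (i, j) \<in> {(1, 3), (3, 1), (3, 4), (4, 3), (2, 4), (4, 2), (4, 5), (5, 4), (5, 6), (6, 5)}"
  by (auto simp: e6_matrix_def doubleton_eq_iff)

lemma e6_fire:
  "e6.fire 1 (e6_state c1 c2 c3 c4 c5 c6) = e6_state (- c1) c2 (c3 + c1) c4 c5 c6"
  "e6.fire 2 (e6_state c1 c2 c3 c4 c5 c6) = e6_state c1 (- c2) c3 (c4 + c2) c5 c6"
  "e6.fire 3 (e6_state c1 c2 c3 c4 c5 c6) = e6_state (c1 + c3) c2 (- c3) (c4 + c3) c5 c6"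
  "e6.fire 4 (e6_state c1 c2 c3 c4 c5 c6) = e6_state c1 (c2 + c4) (c3 + c4) (- c4) (c5 + c4) c6"
  "e6.fire 5 (e6_state c1 c2 c3 c4 c5 c6) = e6_state c1 c2 c3 (c4 + c5) (- c5) (c6 + c5)"
  "e6.fire 6 (e6_state c1 c2 c3 c4 c5 c6) = e6_state c1 c2 c3 c4 (c5 + c6) (- c6)"
  by (rule ext, simp add: e6.fire_def e6_state_def e6_matrix_eq_3)+

lemma e6_score:
  "e6.score (1 # xs) (e6_state c1 c2 c3 c4 c5 c6) =
    (if c1 > 0 then 1 else - 1) + e6.score xs (e6_state (- c1) c2 (c3 + c1) c4 c5 c6)"
  "e6.score (2 # xs) (e6_state c1 c2 c3 c4 c5 c6) =
    (if c2 > 0 then 1 else - 1) + e6.score xs (e6_state c1 (- c2) c3 (c4 + c2) c5 c6)"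
  "e6.score (3 # xs) (e6_state c1 c2 c3 c4 c5 c6) =
    (if c3 > 0 then 1 else - 1) + e6.score xs (e6_state (c1 + c3) c2 (- c3) (c4 + c3) c5 c6)"
  "e6.score (4 # xs) (e6_state c1 c2 c3 c4 c5 c6) =
    (if c4 > 0 then 1 else - 1) + e6.score xs (e6_state c1 (c2 + c4) (c3 + c4) (- c4) (c5 + c4) c6)"
  "e6.score (5 # xs) (e6_state c1 c2 c3 c4 c5 c6) =
    (if c5 > 0 then 1 else - 1) + e6.score xs (e6_state c1 c2 c3 (c4 + c5) (- c5) (c6 + c5))"
  "e6.score (6 # xs) (e6_state c1 c2 c3 c4 c5 c6) =
    (if c6 > 0 then 1 else - 1) + e6.score xs (e6_state c1 c2 c3 c4 (c5 + c6) (- c6))"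
  by (simp_all only: e6.score.simps e6_fire) (simp_all add: e6_state_def)

text \<open>In each pair exactly one positive root is an inversion of the lower but not of the upper
  element. For the first six it is a simple root: w_0 s_i = s_j w_0, where the diagram automorphism
  (swapping 1 with 6 and 3 with 5) sends i to j.\<close>

definition e6_lower :: "nat \<Rightarrow> nat list" where
  "e6_lower x =
    [[1], [2], [3], [4], [5], [6],
     [1,3,4,5,6],
     [1,3,4,2], [6,5,4,2], [6,5,4,3], [1,3,4,2,5,4,3,1],
     [2,4,5,6], [2,4,3,1], [5,4,3,1], [5,4,2,3,4,5,6]] ! x"

text \<open>The common prefix is the sixth power of a bipartite Coxeter element, which is the longest element;
  multiplying it by one of the short words gives a meet-irreducible element.\<close>

definition e6_upper :: "nat \<Rightarrow> nat list" where
  "e6_upper x =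
    concat (replicate 6 [1,4,6,2,3,5]) @
    [[6], [2], [5], [4], [3], [1],
     [1,3,4,5,6],
     [2,4,5,6], [2,4,3,1], [5,4,3,1], [5,4,3,2,4,5,6],
     [1,3,4,2], [6,5,4,2], [6,5,4,3], [1,3,4,5,2,4,3,1]] ! x"

text \<open>The vertices 0 to 5 form the clique, and 6 is the common vertex of the cycles 6, 7, 8, 9, 10 and
  6, 11, 12, 13, 14. Each entry lists only neighbours with a smaller index.\<close>

definition e6_conflicts :: "(nat \<times> nat list) list" where
  "e6_conflicts =
    [(1, [0]), (2, [0,1]), (3, [0,1,2]), (4, [0,1,2,3]), (5, [0,1,2,3,4]),
     (6, [1,2,3,4]),
     (7, [2,3,4,5,6]), (8, [0,2,3,4,7]), (9, [0,1,3,4,8]), (10, [1,3,4,5,9,6]),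
     (11, [0,2,3,4,6]), (12, [2,3,4,5,11]), (13, [1,2,3,5,12]), (14, [0,1,2,3,13,6])]"

definition e6_le :: "nat list \<Rightarrow> nat list \<Rightarrow> bool" where
  "e6_le xs ys \<longleftrightarrow> e6.score ys (\<lambda>_. 1) = e6.score xs (\<lambda>_. 1) + e6.score (rev xs @ ys) (\<lambda>_. 1)"

lemma e6_le_iff:
  assumes "xs \<in> lists {1..6}" "ys \<in> lists {1..6}"
  shows "(e6.elt xs, e6.elt ys) \<in> right_weak_order (coxeter_group {1..6} e6_matrix)
    (coxeter_generators {1..6} e6_matrix) \<longleftrightarrow> e6_le xs ys"
  unfolding e6_le_def by (rule e6.right_weak_order_iff[OF assms])

lemma replicate_6: "replicate 6 x = [x, x, x, x, x, x]"
  by (simp add: numeral_eq_Suc)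

lemma upt_15: "[0..<15] = [0,1,2,3,4,5,6,7,8,9,10,11,12,13,14]"
  by (simp add: upt_rec)

lemma e6_words:
  assumes "x < 15"
  shows "e6_lower x \<in> lists {1..6}" "e6_upper x \<in> lists {1..6}"
proof -
  have "list_all (\<lambda>x. set (e6_lower x @ e6_upper x) \<subseteq> {1..6}) [0..<15]"
    by (simp add: upt_15 e6_lower_def e6_upper_def replicate_6)
  with assms show "e6_lower x \<in> lists {1..6}" "e6_upper x \<in> lists {1..6}"
    by (auto simp: list_all_iff lists_eq_set simp del: One_nat_def)
qed

lemma e6_critical: "list_all (\<lambda>x. \<not> e6_le (e6_lower x) (e6_upper x)) [0..<15]"
  \<comment> \<open>\<open>One_nat_def\<close> would turn the letter 1 into \<open>Suc 0\<close>,
    which the rules \<open>e6_score\<close> do not match.\<close>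
  by (simp add: upt_15 e6_le_def e6_lower_def e6_upper_def e6_state_init e6_score replicate_6
    del: One_nat_def e6.score.simps(2))

lemma e6_conflict:
  "list_all (\<lambda>(x, ys). list_all (\<lambda>y. e6_le (e6_lower x) (e6_upper y) \<and> e6_le (e6_lower y) (e6_upper x)) ys)
    e6_conflicts"
  by (simp add: e6_conflicts_def e6_le_def e6_lower_def e6_upper_def e6_state_init e6_score replicate_6
    del: One_nat_def e6.score.simps(2))

section \<open>Six colours do not suffice\<close>

lemma e6_colouring:
  fixes f :: "nat \<Rightarrow> 'c"
  assumes fin: "finite C" and fC: "f ` {..<15} \<subseteq> C"
    and conflict: "\<And>x ys y. (x, ys) \<in> set e6_conflicts \<Longrightarrow> y \<in> set ys \<Longrightarrow> f x \<noteq> f y"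
  shows "7 \<le> card C"
proof (rule ccontr)
  let ?K = "{f 0, f 1, f 2, f 3, f 4, f 5}"
  have neq: "list_all (\<lambda>(x, ys). list_all (\<lambda>y. f x \<noteq> f y) ys) e6_conflicts"
    using conflict by (fastforce simp: list_all_iff)
  note neq' = neq[unfolded e6_conflicts_def, simplified]
  assume "\<not> 7 \<le> card C"
  moreover have "?K \<subseteq> C" using fC by auto
  moreover have "card ?K = 6" using neq' by auto
  \<comment> \<open>With at most six colours, the clique already uses all of them.\<close>
  ultimately have "?K = C" using fin by (intro card_seteq) auto
  then have K: "f x \<in> ?K" if "x < 15" for x using fC that by auto
  have centre: "f 6 = f 0 \<or> f 6 = f 5" using K[of 6] neq' by auto
  have "f 7 = f 0 \<or> f 7 = f 1" "f 8 = f 1 \<or> f 8 = f 5" "f 9 = f 2 \<or> f 9 = f 5" "f 10 = f 0 \<or> f 10 = f 2"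
    using K[of 7] K[of 8] K[of 9] K[of 10] neq' by simp_all
  \<comment> \<open>From f 6 = f 0 the cycle forces f 7 = f 1, f 8 = f 5, f 9 = f 2, f 10 = f 0, but
    10 conflicts with 6.\<close>
  then have "f 6 \<noteq> f 0" using neq' by auto
  moreover have "f 11 = f 1 \<or> f 11 = f 5" "f 12 = f 0 \<or> f 12 = f 1" "f 13 = f 0 \<or> f 13 = f 4"
    "f 14 = f 4 \<or> f 14 = f 5"
    using K[of 11] K[of 12] K[of 13] K[of 14] neq' by simp_all
  \<comment> \<open>Likewise f 6 = f 5 forces f 11 = f 1, f 12 = f 0, f 13 = f 4, f 14 = f 5, but 14
    conflicts with 6.\<close>
  then have "f 6 \<noteq> f 5" using neq' by auto
  ultimately show False using centre by blast
qed

theorem theorem3p1: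
  shows "order_dimension (carrier (coxeter_group {1..6} e6_matrix))
    (right_weak_order (coxeter_group {1..6} e6_matrix) (coxeter_generators {1..6} e6_matrix)) \<ge> 7"
proof -
  let ?E = "{(x, y). \<exists>ys. (x, ys) \<in> set e6_conflicts \<and> y \<in> set ys}"
  have "enat 7 \<le> order_dimension (carrier (coxeter_group {1..6} e6_matrix))
    (right_weak_order (coxeter_group {1..6} e6_matrix) (coxeter_generators {1..6} e6_matrix))"
  proof (rule order_dimension_ge[where V = "{..<15}" and E = ?E
        and a = "\<lambda>x. e6.elt (e6_lower x)" and b = "\<lambda>x. e6.elt (e6_upper x)"], goal_cases)
    case (1 x)
    then have x: "x < 15" by simp
    have "\<not> e6_le (e6_lower x) (e6_upper x)" using e6_critical x by (simp add: list_all_iff)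
    with e6_words[OF x] show ?case by (simp only: e6_le_iff e6.elt_carrier) simp
  next
    case (2 x y)
    then obtain ys where ys: "(x, ys) \<in> set e6_conflicts" "y \<in> set ys" by auto
    then have xy: "x < 15" "y < 15" by (auto simp: e6_conflicts_def)
    have "e6_le (e6_lower x) (e6_upper y)" "e6_le (e6_lower y) (e6_upper x)"
      using e6_conflict ys by (auto simp: list_all_iff)
    with e6_words[OF xy(1)] e6_words[OF xy(2)] xy show ?case by (simp only: e6_le_iff) simp
  next
    case (3 f C)
    then show ?case by (intro e6_colouring[of C f]) blast+
  qed
  then show ?thesis by (simp add: numeral_eq_enat)
qed

end
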